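(* Let $\varphi:\mathbb{R}^n\to\mathbb{R}$ be a $\mathcal{C}^{1,1}$-smooth function such that for all $x\in\mathbb{R}^n$ and $u\in\mathbb{R}^n\setminus\{0\}$ with $\langle\nabla\varphi(x),u\rangle=0$ one has $\langle z,u\rangle>0$ for all $z\in\partial^2\varphi(x)(u)$. Then $\varphi$ is strictly pseudoconvex.
   Context: $\mathcal{C}^{1,1}$-smooth: $\varphi$ is Fréchet differentiable on $\mathbb{R}^n$ and its gradient $\nabla\varphi:\mathbb{R}^n\to\mathbb{R}^n$ is locally Lipschitz. Strictly pseudoconvex (for differentiable $\varphi$): for all $x,y\in\mathbb{R}^n$ with $x\ne y$, $\varphi(x)\ge\varphi(y)$ implies $\langle\nabla\varphi(x),y-x\rangle<0$. For a proper lower semicontinuous $\psi:\mathbb{R}^m\to(-\infty,\infty]$ and $\bar x$ with $\psi(\bar x)<\infty$, the Fréchet subdifferential is $\widehat\partial\psi(\bar x)=\{x^*\in\mathbb{R}^m : \liminf_{x\to\bar x}\frac{\psi(x)-\psi(\bar x)-\langle x^*,x-\bar x\rangle}{\|x-\bar x\|}\ge 0\}$. The Mordukhovich subdifferential $\partial\psi(\bar x)$ is the set of all $x^*$ for which there are sequences $x_k\to\bar x$ with $\psi(x_k)\to\psi(\bar x)$ and $x_k^*\to x^*$ with $x_k^*\in\widehat\partial\psi(x_k)$ for all $k$. For a set $\Omega$ and $p\in\Omega$, the Mordukhovich normal cone is $N(p;\Omega)=\partial\delta_\Omega(p)$, where $\delta_\Omega$ equals $0$ on $\Omega$ and $\infty$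 elsewhere. Mordukhovich second-order subdifferential of a $\mathcal{C}^{1,1}$-smooth $\varphi$: it is the Mordukhovich coderivative of the gradient mapping, i.e. for $x,u\in\mathbb{R}^n$, $\partial^2\varphi(x)(u)=\{z\in\mathbb{R}^n : (z,-u)\in N((x,\nabla\varphi(x));\mathrm{gph}\,\nabla\varphi)\}$, where $\mathrm{gph}\,\nabla\varphi=\{(y,\nabla\varphi(y)) : y\in\mathbb{R}^n\}\subset\mathbb{R}^n\times\mathbb{R}^n$. *)

theory Defs
  imports "HOL-Analysis.Analysis"
begin

text \<open>Only meaningful where \<open>\<phi>\<close> is differentiable; see \<open>GDERIV_gradient\<close> below.\<close>

definition gradient :: "('a::euclidean_space \<Rightarrow> real) \<Rightarrow> 'a \<Rightarrow> 'a" where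
  "gradient \<phi> x = (THE D. GDERIV \<phi> x :> D)"

lemma GDERIV_gradient:
  fixes \<phi> :: "'a::euclidean_space \<Rightarrow> real"
  assumes "\<phi> differentiable (at x)"
  shows "GDERIV \<phi> x :> gradient \<phi> x"
proof -
  obtain f' where f': "(\<phi> has_derivative f') (at x)"
    using assms unfolding differentiable_def by blast
  then have lin: "linear f'"
    by (rule has_derivative_linear)
  have "f' = (\<lambda>h. inner h (adjoint f' 1))"
    by (rule ext) (use adjoint_works[OF lin, of _ 1] in simp)
  with f' have ex: "GDERIV \<phi> x :> adjoint f' 1"
    unfolding gderiv_def by (rule has_derivative_eq_rhs)
  have uniq: "D = E" if "GDERIV \<phi> x :> D" "GDERIV \<phi> x :> E" for D E
  proof -
    have "(\<lambda>h. inner h D) = (\<lambda>h. inner h E)"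
      using that unfolding gderiv_def by (rule has_derivative_unique)
    then have "\<forall>h. inner h D = inner h E"
      by (blast dest: fun_cong)
    then show ?thesis
      by (simp only: vector_eq_ldot)
  qed
  show ?thesis
    unfolding gradient_def by (rule theI[where P = "\<lambda>D. GDERIV \<phi> x :> D", OF ex]) (rule uniq[OF _ ex])
qed

definition C11_smooth :: "('a::euclidean_space \<Rightarrow> real) \<Rightarrow> bool" where
  "C11_smooth \<phi> \<longleftrightarrow>
     (\<forall>x. \<phi> differentiable (at x)) \<and>
     (\<forall>x. \<exists>r>0. \<exists>L. L-lipschitz_on (ball x r) (gradient \<phi>))"

definition strictly_pseudoconvex :: "('a::euclidean_space \<Rightarrow> real) \<Rightarrow> bool" where
  "strictly_pseudoconvex \<phi> \<longleftrightarrow>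
     (\<forall>x. \<phi> differentiable (at x)) \<and>
     (\<forall>x y. x \<noteq> y \<longrightarrow> \<phi> x \<ge> \<phi> y \<longrightarrow> inner (gradient \<phi> x) (y - x) < 0)"

text \<open>Extended-real-valued functions on \<open>\<real>\<^sup>m\<close> are modelled with values in \<^typ>\<open>ereal\<close>. Both
  subdifferentials are empty by convention at points where the function is not finite.\<close>

definition frechet_subdifferential :: "('a::euclidean_space \<Rightarrow> ereal) \<Rightarrow> 'a \<Rightarrow> 'a set" where
  "frechet_subdifferential \<psi> x =
     {v. \<bar>\<psi> x\<bar> \<noteq> \<infinity> \<and>
         Liminf (at x) (\<lambda>y. (\<psi> y - \<psi> x - ereal (inner v (y - x))) / ereal (norm (y - x))) \<ge> 0}"

definition mordukhovich_subdifferential :: "('a::euclidean_space \<Rightarrow> ereal) \<Rightarrow> 'a \<Rightarrow> 'a set" where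
  "mordukhovich_subdifferential \<psi> x =
     {v. \<bar>\<psi> x\<bar> \<noteq> \<infinity> \<and>
         (\<exists>X V. X \<longlonglongrightarrow> x \<and> (\<lambda>k. \<psi> (X k)) \<longlonglongrightarrow> \<psi> x \<and> V \<longlonglongrightarrow> v \<and>
                (\<forall>k. V k \<in> frechet_subdifferential \<psi> (X k)))}"

definition indicator_fun :: "'a set \<Rightarrow> 'a \<Rightarrow> ereal" where
  "indicator_fun \<Omega> x = (if x \<in> \<Omega> then 0 else \<infinity>)"

definition mordukhovich_normal_cone :: "'a::euclidean_space \<Rightarrow> 'a set \<Rightarrow> 'a set" where
  "mordukhovich_normal_cone p \<Omega> = mordukhovich_subdifferential (indicator_fun \<Omega>) p"

definition graph_of :: "('a \<Rightarrow> 'b) \<Rightarrow> ('a \<times> 'b) set" where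
  "graph_of F = {(y, F y) | y. True}"

text \<open>The product type carries the Euclidean inner product and norm of
  \<open>\<real>\<^sup>n \<times> \<real>\<^sup>n\<close>.\<close>

definition second_order_subdifferential ::
  "('a::euclidean_space \<Rightarrow> real) \<Rightarrow> 'a \<Rightarrow> 'a \<Rightarrow> 'a set" where
  "second_order_subdifferential \<phi> x u =
     {z. (z, - u) \<in> mordukhovich_normal_cone (x, gradient \<phi> x) (graph_of (gradient \<phi>))}"

end

theory Submission
  imports Defs
begin

text \<open>Along a line in direction \<open>u\<close>, the derivative of \<open>\<phi>\<close> is the restriction of
  \<open>f = \<langle>\<nabla>\<phi>(\<cdot>), u\<rangle>\<close>. If \<open>f\<close> vanishes at \<open>x\<close> but is not strictly increasing along the line near
  \<open>x\<close>, then arbitrarily close to \<open>x\<close> there are segments from \<open>a\<close> to \<open>a + su\<close> with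
  \<open>f(a + su) \<le> f(a)\<close>. Minimise \<open>f(y) - \<epsilon>t + K|y - a - tu|\<^sup>2\<close> over \<open>y\<close> near \<open>x\<close> and
  \<open>t \<in> [0, s]\<close>, with \<open>K\<close> so large that the minimiser is interior in \<open>y\<close> and has \<open>t > 0\<close>:
  the optimality conditions give a bounded proximal subgradient \<open>v\<close> of \<open>f\<close> near \<open>x\<close> with
  \<open>\<langle>v, u\<rangle> \<le> \<epsilon>\<close>. Then \<open>(v, -u)\<close> is a Frechet normal to the graph of \<open>\<nabla>\<phi>\<close>, and a limit \<open>z\<close> of
  such \<open>v\<close> lies in \<open>\<partial>\<^sup>2\<phi>(x)(u)\<close> with \<open>\<langle>z, u\<rangle> \<le> 0\<close>, which is excluded. Hence every zero of the
  derivative along a line is a strict crossing upwards, so once the derivative is nonnegative it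
  stays positive.\<close>

section \<open>Proximal subgradients and Frechet normals\<close>

text \<open>On \<Omega> the quadratic estimate bounds the quotient in the \<open>Liminf\<close>
  below by \<open>- (K * norm (q - p))\<close>, which tends to 0; off \<Omega> the quotient is
  infinite.\<close>

lemma frechet_normalI:
  fixes p w :: "'a::euclidean_space"
  assumes "p \<in> \<Omega>"
    and ev: "\<forall>\<^sub>F q in at p. q \<in> \<Omega> \<longrightarrow> inner w (q - p) \<le> K * (norm (q - p))\<^sup>2"
  shows "w \<in> frechet_subdifferential (indicator_fun \<Omega>) p"
proof -
  let ?Q = "\<lambda>q. (indicator_fun \<Omega> q - indicator_fun \<Omega> p - ereal (inner w (q - p))) / ereal (norm (q - p))"
  have lim: "((\<lambda>q. ereal (- (K * norm (q - p)))) \<longlongrightarrow> ereal (- (K * norm (p - p)))) (at p)"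
    by (intro tendsto_intros)
  have "\<forall>\<^sub>F q in at p. ereal (- (K * norm (q - p))) \<le> ?Q q"
    using ev eventually_neq_at_within[of p p UNIV]
  proof eventually_elim
    case (elim q)
    then have n: "norm (q - p) > 0" by simp
    show ?case
    proof (cases "q \<in> \<Omega>")
      case True
      with elim have "inner w (q - p) \<le> (K * norm (q - p)) * norm (q - p)"
        by (simp add: power2_eq_square mult.assoc)
      with n have "inner w (q - p) / norm (q - p) \<le> K * norm (q - p)"
        by (simp add: pos_divide_le_eq)
      with True assms(1) n show ?thesis
        by (simp add: indicator_fun_def zero_ereal_def)
    next
      case False
      with assms(1) n show ?thesis
        by (simp add: indicator_fun_def)
    qed
  qed
  then have "Liminf (at p) (\<lambda>q. ereal (- (K * norm (q - p)))) \<le> Liminf (at p) ?Q"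
    by (rule Liminf_mono)
  moreover have "Liminf (at p) (\<lambda>q. ereal (- (K * norm (q - p)))) = 0"
    using lim_imp_Liminf[OF _ lim] by (simp add: zero_ereal_def)
  ultimately show ?thesis
    using assms(1) by (simp add: frechet_subdifferential_def indicator_fun_def)
qed

text \<open>A one-sided mean value inequality for Lipschitz functions. What matters later is that
  the bound on \<open>v\<close> does not depend on \<open>K\<close>, which may blow up as \<epsilon>
  and \<open>s\<close> shrink.\<close>

lemma proximal_mean_value:
  fixes f :: "'a::euclidean_space \<Rightarrow> real"
  assumes lip: "L-lipschitz_on (cball x r) f"
    and "r > 0" "s > 0" "\<epsilon> > 0"
    and a: "a \<in> ball x (r/2)" and b: "a + s *\<^sub>R u \<in> ball x (r/2)"
    and fab: "f (a + s *\<^sub>R u) \<le> f a"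
  obtains y v K where "y \<in> ball x r" "norm v \<le> 2 * L" "inner v u \<le> \<epsilon>"
    "\<forall>\<^sub>F y' in at y. f y + inner v (y' - y) - K * (norm (y' - y))\<^sup>2 \<le> f y'"
proof -
  have L: "L \<ge> 0" using lip lipschitz_on_nonneg by blast
  \<comment> \<open>The first summand gives \<open>2 * L < K * r\<close>, which keeps the minimiser
    within \<open>r / 2\<close> of the segment; the second gives
    \<open>L^2 < K * (\<epsilon> * s)\<close>, which rules out \<open>t = 0\<close>; the last makes
    \<open>K\<close> positive even if \<open>L = 0\<close>.\<close>
  define K where "K = 2 * L / r + L\<^sup>2 / (\<epsilon> * s) + 1"
  have K: "K > 0" using L \<open>r > 0\<close> \<open>s > 0\<close> \<open>\<epsilon> > 0\<close>
    unfolding K_def by (intro add_nonneg_pos add_nonneg_nonneg) auto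
  have "0 \<le> L\<^sup>2 / (\<epsilon> * s)" "0 \<le> 2 * L / r" using L \<open>r > 0\<close> \<open>s > 0\<close> \<open>\<epsilon> > 0\<close> by auto
  then have "2 * L / r < K" "L\<^sup>2 / (\<epsilon> * s) < K" unfolding K_def by linarith+
  then have KL: "2 * L < K * r" and KL2: "L\<^sup>2 < K * (\<epsilon> * s)"
    using \<open>r > 0\<close> \<open>s > 0\<close> \<open>\<epsilon> > 0\<close> by (simp_all add: pos_divide_less_eq)
  define G where "G = (\<lambda>(y, t). f y - \<epsilon> * t + K * (norm (y - a - t *\<^sub>R u))\<^sup>2)"
  have contf: "continuous_on (cball x r) f" using lip by (rule lipschitz_on_continuous_on)
  have "continuous_on (cball x r \<times> {0..s}) G"
    unfolding G_def case_prod_beta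
    by (intro continuous_intros continuous_on_compose2[OF contf]) auto
  moreover have "compact (cball x r \<times> {0..s})" by (intro compact_Times) auto
  moreover have "cball x r \<times> {0..s} \<noteq> {}" using \<open>r > 0\<close> \<open>s > 0\<close> by auto
  ultimately obtain m where m: "m \<in> cball x r \<times> {0..s}" and minm: "\<And>q. q \<in> cball x r \<times> {0..s} \<Longrightarrow> G m \<le> G q"
    using continuous_attains_inf by metis
  obtain y t where yt: "m = (y, t)" by (cases m)
  have y: "y \<in> cball x r" and t: "0 \<le> t" "t \<le> s" using m yt by auto
  have min: "G (y, t) \<le> G (y', t')" if "y' \<in> cball x r" "0 \<le> t'" "t' \<le> s" for y' t'
    using minm[of "(y', t')"] that yt by auto
  define p where "p = a + t *\<^sub>R u"
  have p: "p \<in> ball x (r/2)"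
  proof -
    have "p = (1 - t / s) *\<^sub>R a + (t / s) *\<^sub>R (a + s *\<^sub>R u)"
      using \<open>s > 0\<close> by (simp add: p_def algebra_simps)
    moreover have "0 \<le> t / s" "t / s \<le> 1" using t \<open>s > 0\<close> by auto
    ultimately show ?thesis
      using convexD[OF convex_ball a b, of "1 - t/s" "t/s"] by simp
  qed
  have pc: "p \<in> cball x r" using p \<open>r > 0\<close> by auto
  \<comment> \<open>Moving \<open>y\<close> to \<open>p\<close> removes the penalty, so the penalty
    at \<open>y\<close> is paid for by the Lipschitz variation of \<open>f\<close>.\<close>
  have "G (y, t) \<le> G (p, t)" using min pc t by blast
  then have "K * (norm (y - p))\<^sup>2 \<le> f p - f y"
    by (simp add: G_def p_def algebra_simps)
  also have "\<dots> \<le> L * norm (y - p)"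
    using lipschitz_onD[OF lip pc y] by (simp add: dist_norm norm_minus_commute)
  finally have "(K * norm (y - p)) * norm (y - p) \<le> L * norm (y - p)"
    by (simp add: power2_eq_square mult.assoc)
  then have Kyp: "K * norm (y - p) \<le> L"
    using L by (cases "norm (y - p) = 0") (auto simp: mult_le_cancel_right)
  have "K * norm (y - p) < K * (r / 2)" using Kyp KL by simp
  then have "norm (y - p) < r / 2" using K by simp
  then have yb: "y \<in> ball x r"
    using p norm_triangle_ineq[of "x - p" "p - y"] by (simp add: dist_norm norm_minus_commute)
  have "t \<noteq> 0"
  proof
    assume "t = 0"
    have ac: "a \<in> cball x r" using a \<open>r > 0\<close> by auto
    \<comment> \<open>The far endpoint has no penalty and gains \<open>\<epsilon> * s\<close>. With
      \<open>X = K * norm (y - a)\<close> this leads to \<open>X^2 + L^2 < L * X\<close>, against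
      \<open>2 * X * L \<le> X^2 + L^2\<close>.\<close>
    have "G (y, 0) \<le> G (a + s *\<^sub>R u, s)"
      using min[of "a + s *\<^sub>R u" s] \<open>t = 0\<close> b \<open>s > 0\<close> \<open>r > 0\<close> by auto
    then have 1: "f y + K * (norm (y - a))\<^sup>2 \<le> f a - \<epsilon> * s"
      using fab by (simp add: G_def)
    have "f a - f y \<le> L * norm (y - a)"
      using lipschitz_onD[OF lip ac y] by (simp add: dist_norm norm_minus_commute)
    with 1 have "K * (norm (y - a))\<^sup>2 + \<epsilon> * s \<le> L * norm (y - a)" by linarith
    then have "K * (K * (norm (y - a))\<^sup>2 + \<epsilon> * s) \<le> K * (L * norm (y - a))"
      using K by (intro mult_left_mono) auto
    then have "(K * norm (y - a))\<^sup>2 + K * (\<epsilon> * s) \<le> L * (K * norm (y - a))"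
      by (simp add: algebra_simps power2_eq_square)
    then have "(K * norm (y - a))\<^sup>2 + L\<^sup>2 < L * (K * norm (y - a))"
      using KL2 by linarith
    moreover have "0 \<le> L * (K * norm (y - a))" using L K by simp
    ultimately show False
      using sum_squares_bound[of "K * norm (y - a)" L] by (simp add: algebra_simps)
  qed
  with t have "t > 0" by simp
  \<comment> \<open>The negative gradient at \<open>y\<close> of the penalty
    \<open>K * (norm (y - p))^2\<close>.\<close>
  define v where "v = - (2 * K) *\<^sub>R (y - p)"
  have nv: "norm v \<le> 2 * L" using Kyp K by (simp add: v_def)
  have vu: "inner v u \<le> \<epsilon>"
  proof (rule ccontr)
    assume "\<not> inner v u \<le> \<epsilon>"
    \<comment> \<open>The part of \<open>G (y, t')\<close> that depends on \<open>t'\<close>. A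
      positive derivative at \<open>t\<close> would let a smaller parameter lower \<open>G\<close>;
      only a move to the left is needed, so \<open>t = s\<close> is allowed.\<close>
    let ?h = "\<lambda>t'. - \<epsilon> * t' + K * inner (y - a - t' *\<^sub>R u) (y - a - t' *\<^sub>R u)"
    have "(?h has_real_derivative (- \<epsilon> + inner v u)) (at t)"
    proof -
      have "?h = (\<lambda>t'. - \<epsilon> * t' + K * (inner (y - a) (y - a) - 2 * t' * inner (y - a) u + t'\<^sup>2 * inner u u))"
        by (simp add: fun_eq_iff inner_diff_left inner_diff_right inner_commute algebra_simps power2_eq_square)
      moreover have "(\<dots> has_real_derivative (- \<epsilon> + inner v u)) (at t)"
        by (auto intro!: derivative_eq_intros
              simp: v_def p_def inner_diff_left inner_add_left algebra_simps)
      ultimately show ?thesis by simp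
    qed
    then obtain d where d: "d > 0" "\<And>h. 0 < h \<Longrightarrow> h < d \<Longrightarrow> ?h (t - h) < ?h t"
      using DERIV_pos_inc_left[of ?h "- \<epsilon> + inner v u" t] \<open>\<not> inner v u \<le> \<epsilon>\<close> by auto
    define h where "h = min (d/2) t"
    have h: "0 < h" "h < d" "h \<le> t" using \<open>t > 0\<close> d(1) by (auto simp: h_def)
    have "G (y, t) \<le> G (y, t - h)" using min[of y "t - h"] y t h by auto
    then have "?h t \<le> ?h (t - h)" by (simp add: G_def power2_norm_eq_inner)
    with d(2)[OF h(1,2)] show False by simp
  qed
  have "\<forall>\<^sub>F y' in at y. y' \<in> ball x r"
    using yb by (intro eventually_at_in_open') auto
  then have "\<forall>\<^sub>F y' in at y. f y + inner v (y' - y) - K * (norm (y' - y))\<^sup>2 \<le> f y'"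
  proof eventually_elim
    case (elim y')
    have "G (y, t) \<le> G (y', t)" using min[of y' t] elim t by auto
    then have "f y + K * (norm (y - p))\<^sup>2 \<le> f y' + K * (norm (y' - p))\<^sup>2"
      by (simp add: G_def p_def algebra_simps)
    \<comment> \<open>Expanding the penalty about \<open>y\<close> leaves a linear term, which is
      the pairing with \<open>v\<close>, and a quadratic error.\<close>
    moreover have "(norm (y' - p))\<^sup>2
        = (norm (y' - y))\<^sup>2 + 2 * inner (y - p) (y' - y) + (norm (y - p))\<^sup>2"
      by (simp add: power2_norm_eq_inner inner_diff_left inner_diff_right inner_commute algebra_simps)
    ultimately have "f y \<le> f y' + K * (norm (y' - y))\<^sup>2 + 2 * K * inner (y - p) (y' - y)"
      by (simp only: distrib_left)
    moreover have "inner v (y' - y) = - (2 * K * inner (y - p) (y' - y))"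
      by (simp only: v_def inner_scaleR_left)
    ultimately show ?case by linarith
  qed
  with yb nv vu that show ?thesis by blast
qed

text \<open>Pairing \<open>(v, - u)\<close> with a displacement along the graph gives
  \<open>inner v (y' - y) - inner (g y' - g y) u\<close>, which the hypothesis bounds by a quadratic
  in \<open>y' - y\<close>, and that component is no longer than the whole displacement.\<close>

lemma proximal_imp_frechet_normal_graph:
  fixes g :: "'a::euclidean_space \<Rightarrow> 'a"
  assumes "\<forall>\<^sub>F y' in at y. inner (g y) u + inner v (y' - y) - K * (norm (y' - y))\<^sup>2 \<le> inner (g y') u"
  shows "(v, - u) \<in> frechet_subdifferential (indicator_fun (graph_of g)) (y, g y)"
\<comment> \<open>The sign of \<open>K\<close> is arbitrary here; enlarging the norm needs a
  nonnegative factor.\<close>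
proof (rule frechet_normalI[where K = "\<bar>K\<bar>"])
  show "(y, g y) \<in> graph_of g" by (auto simp: graph_of_def)
  obtain d where "d > 0" and d: "\<And>y'. y' \<noteq> y \<Longrightarrow> dist y' y < d \<Longrightarrow>
      inner (g y) u + inner v (y' - y) - K * (norm (y' - y))\<^sup>2 \<le> inner (g y') u"
    using assms unfolding eventually_at by auto
  show "\<forall>\<^sub>F q in at (y, g y). q \<in> graph_of g \<longrightarrow>
      inner (v, - u) (q - (y, g y)) \<le> \<bar>K\<bar> * (norm (q - (y, g y)))\<^sup>2"
    unfolding eventually_at
  proof (intro exI[of _ d] conjI ballI impI \<open>d > 0\<close>)
    fix q assume q: "q \<noteq> (y, g y) \<and> dist q (y, g y) < d" and "q \<in> graph_of g"
    then obtain y' where y': "q = (y', g y')" by (auto simp: graph_of_def)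
    have ny: "norm (y' - y) \<le> norm (q - (y, g y))"
      unfolding y' using norm_fst_le[of "y' - y" "g y' - g y"] by simp
    have "y' \<noteq> y" using q y' by auto
    moreover have "dist y' y < d" using ny q by (simp add: dist_norm)
    ultimately have "inner (v, - u) (q - (y, g y)) \<le> K * (norm (y' - y))\<^sup>2"
      using d[of y'] by (simp add: y' inner_diff_left inner_diff_right inner_commute)
    also have "\<dots> \<le> \<bar>K\<bar> * (norm (q - (y, g y)))\<^sup>2"
      using ny by (intro mult_mono power_mono) auto
    finally show "inner (v, - u) (q - (y, g y)) \<le> \<bar>K\<bar> * (norm (q - (y, g y)))\<^sup>2" .
  qed
qed

section \<open>Passage to the limit in the second-order subdifferential\<close>

lemma second_order_subdifferentialI:
  assumes "Y \<longlonglongrightarrow> x" "continuous (at x) (gradient \<phi>)" "V \<longlonglongrightarrow> z"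
    and "\<And>k. (V k, - u) \<in> frechet_subdifferential (indicator_fun (graph_of (gradient \<phi>))) (Y k, gradient \<phi> (Y k))"
  shows "z \<in> second_order_subdifferential \<phi> x u"
proof -
  have "(\<lambda>k. gradient \<phi> (Y k)) \<longlonglongrightarrow> gradient \<phi> x"
    using assms(1,2) by (simp add: isCont_tendsto_compose)
  with assms(1) have 1: "(\<lambda>k. (Y k, gradient \<phi> (Y k))) \<longlonglongrightarrow> (x, gradient \<phi> x)"
    by (rule tendsto_Pair)
  have 2: "(\<lambda>k. (V k, - u)) \<longlonglongrightarrow> (z, - u)"
    using assms(3) by (intro tendsto_Pair tendsto_const)
  have 3: "indicator_fun (graph_of (gradient \<phi>)) (y, gradient \<phi> y) = 0" for y
    by (auto simp: indicator_fun_def graph_of_def)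
  show ?thesis
    unfolding second_order_subdifferential_def mordukhovich_normal_cone_def
      mordukhovich_subdifferential_def mem_Collect_eq
    using assms(4) 1 2
    by (intro conjI exI[of _ "\<lambda>k. (Y k, gradient \<phi> (Y k))"] exI[of _ "\<lambda>k. (V k, - u)"])
       (auto simp: 3)
qed

text \<open>The mean value inequality on ever smaller balls yields Frechet normals
  \<open>(V k, - u)\<close> with a bound on \<open>V k\<close> uniform in \<open>k\<close>, so
  compactness supplies the limit \<open>z\<close>.\<close>

lemma nonpos_second_order_subgradient:
  fixes \<phi> :: "'a::euclidean_space \<Rightarrow> real"
  assumes "C11_smooth \<phi>"
    and seg: "\<And>\<delta>. \<delta> > 0 \<Longrightarrow> \<exists>a s. s > 0 \<and> a \<in> ball x \<delta> \<and> a + s *\<^sub>R u \<in> ball x \<delta> \<and>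
            inner (gradient \<phi> (a + s *\<^sub>R u)) u \<le> inner (gradient \<phi> a) u"
  obtains z where "z \<in> second_order_subdifferential \<phi> x u" "inner z u \<le> 0"
proof -
  let ?g = "gradient \<phi>"
  obtain r L where "r > 0" and lip: "L-lipschitz_on (ball x r) ?g"
    using assms(1) unfolding C11_smooth_def by blast
  define f where "f y = inner (?g y) u" for y
  define M where "M = L * norm u"
  have lipf: "M-lipschitz_on (ball x r) f"
  proof (rule lipschitz_onI)
    show "M \<ge> 0" using lipschitz_on_nonneg[OF lip] by (simp add: M_def)
    fix y y' assume "y \<in> ball x r" "y' \<in> ball x r"
    then have "norm (?g y - ?g y') \<le> L * norm (y - y')"
      using lipschitz_onD[OF lip] by (simp add: dist_norm)
    then have "norm (?g y - ?g y') * norm u \<le> L * norm (y - y') * norm u"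
      by (intro mult_right_mono) auto
    moreover have "\<bar>f y - f y'\<bar> \<le> norm (?g y - ?g y') * norm u"
      using Cauchy_Schwarz_ineq2[of "?g y - ?g y'" u] by (simp add: f_def inner_diff_left)
    ultimately show "dist (f y) (f y') \<le> M * dist y y'"
      by (simp add: M_def dist_norm algebra_simps)
  qed
  have cont: "continuous (at x) ?g"
    using lipschitz_on_continuous_on[OF lip] \<open>r > 0\<close>
    by (simp add: continuous_on_eq_continuous_at)
  \<comment> \<open>Serves both as ball radius and as the tolerance \<epsilon>; starting from
    \<open>r / 2\<close> keeps the closed balls inside the open ball where the gradient is
    Lipschitz.\<close>
  define \<rho> where "\<rho> k = (r / 2) / real (Suc k)" for k
  have \<rho>: "\<rho> k > 0" "\<rho> k < r" for k
    using \<open>r > 0\<close> by (simp_all add: \<rho>_def field_simps)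
       (smt (verit) mult_nonneg_nonneg of_nat_0_le_iff)
  have \<rho>_lim: "\<rho> \<longlonglongrightarrow> 0"
    unfolding \<rho>_def by (rule tendsto_divide_0[OF tendsto_const])
      (intro filterlim_compose[OF tendsto_of_nat] filterlim_Suc)
  have "\<exists>y v. y \<in> ball x (\<rho> k) \<and> norm v \<le> 2 * M \<and> inner v u \<le> \<rho> k \<and>
      (v, - u) \<in> frechet_subdifferential (indicator_fun (graph_of ?g)) (y, ?g y)" for k
  proof -
    obtain a s where as: "s > 0" "a \<in> ball x (\<rho> k / 2)" "a + s *\<^sub>R u \<in> ball x (\<rho> k / 2)"
        "f (a + s *\<^sub>R u) \<le> f a"
      using seg[of "\<rho> k / 2"] \<rho>(1)[of k] unfolding f_def by auto
    have lipk: "M-lipschitz_on (cball x (\<rho> k)) f"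
      using lipf by (rule lipschitz_on_subset) (use \<rho>(2)[of k] in auto)
    obtain y v K where y: "y \<in> ball x (\<rho> k)" "norm v \<le> 2 * M" "inner v u \<le> \<rho> k"
      and ev: "\<forall>\<^sub>F y' in at y. f y + inner v (y' - y) - K * (norm (y' - y))\<^sup>2 \<le> f y'"
      using proximal_mean_value[OF lipk \<rho>(1) as(1) \<rho>(1) as(2-4)] .
    from proximal_imp_frechet_normal_graph[OF ev[unfolded f_def]] y show ?thesis by blast
  qed
  then obtain Y V where YV: "\<And>k. Y k \<in> ball x (\<rho> k)" "\<And>k. norm (V k) \<le> 2 * M"
      "\<And>k. inner (V k) u \<le> \<rho> k"
      "\<And>k. (V k, - u) \<in> frechet_subdifferential (indicator_fun (graph_of ?g)) (Y k, ?g (Y k))"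
    by metis
  have "Y \<longlonglongrightarrow> x"
  proof (rule metric_tendsto_imp_tendsto[OF \<rho>_lim])
    show "\<forall>\<^sub>F k in sequentially. dist (Y k) x \<le> dist (\<rho> k) 0"
      using YV(1) \<rho>(1) by (intro always_eventually allI) (auto simp: dist_commute less_imp_le)
  qed
  have "bounded (range V)" using YV(2) by (auto simp: bounded_iff)
  then obtain z \<sigma> where \<sigma>: "strict_mono (\<sigma> :: nat \<Rightarrow> nat)" and Vz: "(V \<circ> \<sigma>) \<longlonglongrightarrow> z"
    using bounded_imp_convergent_subsequence by blast
  have "z \<in> second_order_subdifferential \<phi> x u"
    using LIMSEQ_subseq_LIMSEQ[OF \<open>Y \<longlonglongrightarrow> x\<close> \<sigma>] cont Vz
    by (rule second_order_subdifferentialI) (simp add: YV(4))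
  moreover have "inner z u \<le> 0"
  proof (rule LIMSEQ_le)
    show "(\<lambda>k. inner ((V \<circ> \<sigma>) k) u) \<longlonglongrightarrow> inner z u" using Vz by (intro tendsto_intros)
    show "(\<rho> \<circ> \<sigma>) \<longlonglongrightarrow> 0" using \<rho>_lim \<sigma> by (rule LIMSEQ_subseq_LIMSEQ)
  qed (use YV(3) in auto)
  ultimately show ?thesis using that by blast
qed

section \<open>Sign of the derivative along a line\<close>

text \<open>The first later point with \<open>h \<le> 0\<close> would be a zero approached from the
  left through positive values, contrary to \<open>left\<close>.\<close>

lemma positive_if_zeros_cross_upwards:
  fixes h :: "real \<Rightarrow> real"
  assumes cont: "continuous_on UNIV h"
    and right: "\<And>t. h t = 0 \<Longrightarrow> \<forall>\<^sub>F s in at_right t. h s > 0"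
    and left: "\<And>t. h t = 0 \<Longrightarrow> \<forall>\<^sub>F s in at_left t. h s < 0"
    and "h 0 \<ge> 0" "t > 0"
  shows "h t > 0"
proof (rule ccontr)
  assume "\<not> h t > 0"
  have "\<forall>\<^sub>F s in at_right 0. h s > 0"
  proof (cases "h 0 = 0")
    case False
    with \<open>h 0 \<ge> 0\<close> have "h 0 > 0" by simp
    moreover have "(h \<longlongrightarrow> h 0) (at_right 0)"
      using cont by (simp add: continuous_on_def filterlim_at_split)
    ultimately show ?thesis by (rule order_tendstoD(1)[rotated])
  qed (rule right)
  then obtain b where "b > 0" and b: "\<And>s. 0 < s \<Longrightarrow> s < b \<Longrightarrow> h s > 0"
    unfolding eventually_at_right_field by auto
  \<comment> \<open>Starting the search at \<open>c > 0\<close> keeps the infimum away from 0, where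
    \<open>h\<close> may vanish.\<close>
  define c where "c = min (b / 2) t"
  have c: "0 < c" "c < b" "c \<le> t" using \<open>b > 0\<close> \<open>t > 0\<close> by (auto simp: c_def)
  define S where "S = {s \<in> {c..t}. h s \<le> 0}"
  have "S = {c..t} \<inter> h -` {..0}" by (auto simp: S_def)
  also have "closed \<dots>"
    using cont by (intro closed_Int closed_vimage) auto
  finally have "closed S" .
  have "t \<in> S" using \<open>\<not> h t > 0\<close> c by (auto simp: S_def)
  have bdd: "bdd_below S" by (auto simp: S_def intro!: bdd_belowI[of _ c])
  define \<tau> where "\<tau> = Inf S"
  have "\<tau> \<in> S" unfolding \<tau>_def using \<open>t \<in> S\<close> bdd \<open>closed S\<close> by (intro closed_contains_Inf) auto
  then have \<tau>: "c \<le> \<tau>" "\<tau> \<le> t" "h \<tau> \<le> 0" by (auto simp: S_def)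
  have pos: "h s > 0" if "0 < s" "s < \<tau>" for s
  proof (rule ccontr)
    assume "\<not> h s > 0"
    with b[of s] that have "s \<ge> b" by force
    with \<open>\<not> h s > 0\<close> that c \<tau> have "s \<in> S" by (auto simp: S_def)
    then have "\<tau> \<le> s" unfolding \<tau>_def using bdd by (rule cInf_lower)
    with that show False by simp
  qed
  have ev: "\<forall>\<^sub>F s in at_left \<tau>. h s > 0"
    unfolding eventually_at_left_field using pos c \<tau> by (intro exI[of _ 0]) auto
  have "(h \<longlongrightarrow> h \<tau>) (at_left \<tau>)"
    using cont by (simp add: continuous_on_def filterlim_at_split)
  then have "0 \<le> h \<tau>"
    by (rule tendsto_lowerbound) (use ev in \<open>auto elim: eventually_mono\<close>)
  with \<tau> have "h \<tau> = 0" by simp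
  from left[OF this] ev have "\<forall>\<^sub>F s in at_left \<tau>. False"
    by eventually_elim simp
  then show False by simp
qed

theorem theorem4p2:
  fixes \<phi> :: "real ^ 'n \<Rightarrow> real"
  assumes "C11_smooth \<phi>"
    and "\<And>x u z. u \<noteq> 0 \<Longrightarrow> inner (gradient \<phi> x) u = 0 \<Longrightarrow>
           z \<in> second_order_subdifferential \<phi> x u \<Longrightarrow> inner z u > 0"
  shows "strictly_pseudoconvex \<phi>"
  unfolding strictly_pseudoconvex_def
proof (intro conjI allI impI)
  show diff: "\<phi> differentiable (at x)" for x
    using assms(1) by (simp add: C11_smooth_def)
  fix x y :: "real ^ 'n" assume "x \<noteq> y" "\<phi> x \<ge> \<phi> y"
  define u where "u = y - x"
  have "u \<noteq> 0" using \<open>x \<noteq> y\<close> by (simp add: u_def)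
  define h where "h t = inner (gradient \<phi> (x + t *\<^sub>R u)) u" for t
  have contg: "continuous_on UNIV (gradient \<phi>)"
  proof (rule continuous_at_imp_continuous_on, rule ballI)
    fix x
    obtain r L where "r > 0" "L-lipschitz_on (ball x r) (gradient \<phi>)"
      using assms(1) unfolding C11_smooth_def by blast
    then show "isCont (gradient \<phi>) x"
      using lipschitz_on_continuous_on by (fastforce simp: continuous_on_eq_continuous_at)
  qed
  have conth: "continuous_on UNIV h"
    unfolding h_def by (intro continuous_intros continuous_on_compose2[OF contg]) auto
  have strictly_increasing: "\<exists>\<delta>>0. \<forall>s s'. \<bar>s - t\<bar> < \<delta> \<longrightarrow> \<bar>s' - t\<bar> < \<delta> \<longrightarrow> s < s' \<longrightarrow> h s < h s'"
    if "h t = 0" for t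
  proof (rule ccontr)
    let ?x = "x + t *\<^sub>R u"
    assume contra: "\<not> ?thesis"
    have "\<exists>a s. s > 0 \<and> a \<in> ball ?x \<delta> \<and> a + s *\<^sub>R u \<in> ball ?x \<delta> \<and>
        inner (gradient \<phi> (a + s *\<^sub>R u)) u \<le> inner (gradient \<phi> a) u" if "\<delta> > 0" for \<delta>
    proof -
      \<comment> \<open>Parameters on the line are scaled by \<open>norm u\<close> when measured in
        space.\<close>
      have "\<delta> / norm u > 0" using that \<open>u \<noteq> 0\<close> by simp
      with contra obtain s s' where s: "\<bar>s - t\<bar> < \<delta> / norm u" "\<bar>s' - t\<bar> < \<delta> / norm u" "s < s'" "h s' \<le> h s"
        by (meson not_less)
      have in_ball: "x + q *\<^sub>R u \<in> ball ?x \<delta>" if "\<bar>q - t\<bar> < \<delta> / norm u" for q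
      proof -
        have "x + t *\<^sub>R u - (x + q *\<^sub>R u) = (t - q) *\<^sub>R u" by (simp add: algebra_simps)
        then show ?thesis
          using that \<open>u \<noteq> 0\<close> by (simp add: dist_norm pos_less_divide_eq abs_minus_commute)
      qed
      have eq: "x + s *\<^sub>R u + (s' - s) *\<^sub>R u = x + s' *\<^sub>R u" by (simp add: algebra_simps)
      show ?thesis
        using s in_ball[OF s(1)] in_ball[OF s(2)]
        by (intro exI[of _ "x + s *\<^sub>R u"] exI[of _ "s' - s"]) (simp only: eq h_def, simp)
    qed
    with assms(1) obtain z where "z \<in> second_order_subdifferential \<phi> ?x u" "inner z u \<le> 0"
      by (rule nonpos_second_order_subgradient)
    with assms(2)[OF \<open>u \<noteq> 0\<close>, of ?x z] that show False by (simp add: h_def)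
  qed
  have right: "\<forall>\<^sub>F s in at_right t. h s > 0" if "h t = 0" for t
  proof -
    obtain \<delta> where "\<delta> > 0" "\<And>s s'. \<bar>s - t\<bar> < \<delta> \<Longrightarrow> \<bar>s' - t\<bar> < \<delta> \<Longrightarrow> s < s' \<Longrightarrow> h s < h s'"
      using strictly_increasing[OF \<open>h t = 0\<close>] by blast
    from this(1) this(2)[of t] that show ?thesis
      unfolding eventually_at_right_field by (intro exI[of _ "t + \<delta>"]) auto
  qed
  have left: "\<forall>\<^sub>F s in at_left t. h s < 0" if "h t = 0" for t
  proof -
    obtain \<delta> where "\<delta> > 0" "\<And>s s'. \<bar>s - t\<bar> < \<delta> \<Longrightarrow> \<bar>s' - t\<bar> < \<delta> \<Longrightarrow> s < s' \<Longrightarrow> h s < h s'"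
      using strictly_increasing[OF \<open>h t = 0\<close>] by blast
    from this(1) this(2)[of _ t] that show ?thesis
      unfolding eventually_at_left_field by (intro exI[of _ "t - \<delta>"]) auto
  qed
  have deriv: "((\<lambda>t. \<phi> (x + t *\<^sub>R u)) has_real_derivative h t) (at t)" for t
  proof -
    have "(\<phi> has_derivative (\<lambda>k. inner k (gradient \<phi> (x + t *\<^sub>R u)))) (at (x + t *\<^sub>R u))"
      using GDERIV_gradient[OF diff] unfolding gderiv_def .
    moreover have "((\<lambda>t. x + t *\<^sub>R u) has_derivative (\<lambda>k. k *\<^sub>R u)) (at t)"
      by (auto intro!: derivative_eq_intros)
    ultimately have "((\<lambda>t. \<phi> (x + t *\<^sub>R u)) has_derivative
        (\<lambda>k. inner (k *\<^sub>R u) (gradient \<phi> (x + t *\<^sub>R u)))) (at t)"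
      by (rule has_derivative_compose[rotated])
    then show ?thesis
      unfolding has_field_derivative_def h_def
      by (rule has_derivative_eq_rhs) (simp add: fun_eq_iff inner_commute)
  qed
  show "inner (gradient \<phi> x) (y - x) < 0"
  proof (rule ccontr)
    assume "\<not> inner (gradient \<phi> x) (y - x) < 0"
    then have "h 0 \<ge> 0" by (simp add: h_def u_def)
    \<comment> \<open>If \<open>h 0\<close> were nonnegative, the mean value theorem would give
      \<open>\<phi> y - \<phi> x = h \<xi>\<close>, which is positive.\<close>
    obtain \<xi> :: real where "0 < \<xi>" "\<phi> (x + 1 *\<^sub>R u) - \<phi> (x + 0 *\<^sub>R u) = (1 - 0) * h \<xi>"
      using MVT2[of 0 1 "\<lambda>t. \<phi> (x + t *\<^sub>R u)" h] deriv by auto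
    moreover have "h \<xi> > 0"
      using conth right left \<open>h 0 \<ge> 0\<close> \<open>0 < \<xi>\<close> by (rule positive_if_zeros_cross_upwards)
    ultimately show False using \<open>\<phi> x \<ge> \<phi> y\<close> by (simp add: u_def)
  qed
qed

end
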